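(* Let $K$ be a field of characteristic zero, let $n\ge 2$, let $P_n=K[x_1,\dots,x_n]$ be the polynomial algebra, and let $\sigma\in\mathrm{Aut}_K(P_n)$ be the $K$-algebra automorphism given by $\sigma(x_1)=x_1-1$ and $\sigma(x_i)=x_i+x_{i-1}$ for $2\le i\le n$. Then the algebra of invariants $P_n^\sigma$ is a polynomial algebra $K[y_2,\dots,y_n]$ in the $n-1$ variables given by $$y_{i+1}=\sum_{j=1}^{i}\phi_{-i+j}\,x_{j+1}+i\,\sigma^{-1}(\phi_{-i-1}),\qquad i=1,\dots,n-1,$$ where $\phi_0:=1$ and $\phi_{-i}:=\frac{x_1(x_1-1)\cdots(x_1-i+1)}{i!}$ for $i\ge 1$. (Moreover $\deg(y_{i+1})=i+1$.)
   Context: For an automorphism $\sigma$ of an algebra $A$, $A^\sigma=\{a\in A:\sigma(a)=a\}$. The degree is the total degree in $x_1,\dots,x_n$. *)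

theory Defs
  imports "HOL-Library.Poly_Mapping" "HOL.Hull"
begin

text \<open>
  A polynomial in the indeterminates \<open>x\<^sub>i\<close> (\<open>i :: nat\<close>) over \<open>'k\<close> is a finitely supported map
  from monomials to coefficients, a monomial being a finitely supported map from indices to
  exponents. Multiplication on \<^typ>\<open>(nat \<Rightarrow>\<^sub>0 nat) \<Rightarrow>\<^sub>0 'k::comm_ring_1\<close> is the library's
  convolution product.
\<close>

type_synonym 'k mpoly = "(nat \<Rightarrow>\<^sub>0 nat) \<Rightarrow>\<^sub>0 'k"

definition Const :: "'k::comm_ring_1 \<Rightarrow> 'k mpoly" where
  "Const c = Poly_Mapping.single 0 c"

definition Var :: "nat \<Rightarrow> 'k::comm_ring_1 mpoly" where
  "Var i = Poly_Mapping.single (Poly_Mapping.single i 1) 1"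

text \<open>The polynomials involving only the indeterminates with index in \<open>V\<close>.\<close>

definition polys_in :: "nat set \<Rightarrow> 'k::comm_ring_1 mpoly set" where
  "polys_in V = {p. \<forall>m \<in> Poly_Mapping.keys p. Poly_Mapping.keys m \<subseteq> V}"

abbreviation P_n :: "nat \<Rightarrow> 'k::comm_ring_1 mpoly set" where
  "P_n n \<equiv> polys_in {1..n}"

definition subst :: "(nat \<Rightarrow> 'k mpoly) \<Rightarrow> 'k mpoly \<Rightarrow> 'k::comm_ring_1 mpoly" where
  "subst g p = (\<Sum>m \<in> Poly_Mapping.keys p.
     Const (Poly_Mapping.lookup p m) *
     (\<Prod>i \<in> Poly_Mapping.keys m. g i ^ Poly_Mapping.lookup m i))"

text \<open>The zero polynomial gets degree \<open>0\<close>.\<close>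

definition total_degree :: "'k::comm_ring_1 mpoly \<Rightarrow> nat" where
  "total_degree p = Max (insert 0
     ((\<lambda>m. \<Sum>i \<in> Poly_Mapping.keys m. Poly_Mapping.lookup m i) ` Poly_Mapping.keys p))"

text \<open>\<open>K\<close>-linearity of a ring homomorphism amounts to fixing the constants; the values of
  \<open>\<sigma>\<close> outside \<open>A\<close> are irrelevant.\<close>

definition K_algebra_automorphism ::
    "'k::comm_ring_1 mpoly set \<Rightarrow> ('k mpoly \<Rightarrow> 'k mpoly) \<Rightarrow> bool" where
  "K_algebra_automorphism A \<sigma> \<longleftrightarrow>
     bij_betw \<sigma> A A \<and>
     (\<forall>c. \<sigma> (Const c) = Const c) \<and>
     (\<forall>p\<in>A. \<forall>q\<in>A. \<sigma> (p + q) = \<sigma> p + \<sigma> q) \<and>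
     (\<forall>p\<in>A. \<forall>q\<in>A. \<sigma> (p * q) = \<sigma> p * \<sigma> q)"

definition invariants :: "'k::comm_ring_1 mpoly set \<Rightarrow> ('k mpoly \<Rightarrow> 'k mpoly) \<Rightarrow> 'k mpoly set" where
  "invariants A \<sigma> = {p \<in> A. \<sigma> p = p}"

definition K_subalgebra :: "'k::comm_ring_1 mpoly set \<Rightarrow> bool" where
  "K_subalgebra B \<longleftrightarrow>
     (\<forall>c. Const c \<in> B) \<and> (\<forall>p\<in>B. \<forall>q\<in>B. p + q \<in> B) \<and> (\<forall>p\<in>B. \<forall>q\<in>B. p * q \<in> B)"

definition alg_independent :: "nat set \<Rightarrow> (nat \<Rightarrow> 'k::comm_ring_1 mpoly) \<Rightarrow> bool" where
  "alg_independent I y \<longleftrightarrow> (\<forall>f \<in> polys_in I. subst y f = 0 \<longrightarrow> f = 0)"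

text \<open>\<open>A\<close> is the polynomial algebra in the family \<open>(y\<^sub>i)\<close>, \<open>i \<in> I\<close>: the family generates
  \<open>A\<close> and satisfies no nontrivial polynomial relation.\<close>

definition is_polynomial_algebra_in ::
    "'k::comm_ring_1 mpoly set \<Rightarrow> nat set \<Rightarrow> (nat \<Rightarrow> 'k mpoly) \<Rightarrow> bool" where
  "is_polynomial_algebra_in A I y \<longleftrightarrow> A = K_subalgebra hull (y ` I) \<and> alg_independent I y"

text \<open>\<open>phi k\<close> is the paper's \<open>\<phi>\<close> with index \<open>-k\<close>.\<close>

definition phi :: "nat \<Rightarrow> 'k::field_char_0 mpoly" where
  "phi k = Const (1 / fact k) * (\<Prod>j<k. Var 1 - of_nat j)"

lemma subst_ext:
  assumes "finite S" "Poly_Mapping.keys p \<subseteq> S"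
  shows "subst g p = (\<Sum>m\<in>S. Const (Poly_Mapping.lookup p m) *
     (\<Prod>i \<in> Poly_Mapping.keys m. g i ^ Poly_Mapping.lookup m i))"
  unfolding subst_def using assms
  by (intro sum.mono_neutral_left) (auto simp: Const_def in_keys_iff)

lemma mono_ext:
  assumes "finite S" "Poly_Mapping.keys m \<subseteq> S"
  shows "(\<Prod>i \<in> Poly_Mapping.keys m. (g i :: 'a::comm_monoid_mult) ^ Poly_Mapping.lookup m i) = (\<Prod>i\<in>S. g i ^ Poly_Mapping.lookup m i)"
  using assms by (intro prod.mono_neutral_left) (auto simp: in_keys_iff)

lemma mono_add: "(\<Prod>i \<in> Poly_Mapping.keys (m+m'). (g i :: 'a::comm_monoid_mult) ^ Poly_Mapping.lookup (m+m') i) =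
  (\<Prod>i \<in> Poly_Mapping.keys m. g i ^ Poly_Mapping.lookup m i) * (\<Prod>i \<in> Poly_Mapping.keys m'. g i ^ Poly_Mapping.lookup m' i)"
proof -
  let ?S = "Poly_Mapping.keys m \<union> Poly_Mapping.keys m'"
  have "Poly_Mapping.keys (m+m') \<subseteq> ?S" by (rule Poly_Mapping.keys_add)
  then have "(\<Prod>i \<in> Poly_Mapping.keys (m+m'). g i ^ Poly_Mapping.lookup (m+m') i)
      = (\<Prod>i\<in>?S. g i ^ Poly_Mapping.lookup (m+m') i)"
    by (intro mono_ext) auto
  also have "\<dots> = (\<Prod>i\<in>?S. g i ^ Poly_Mapping.lookup m i) * (\<Prod>i\<in>?S. g i ^ Poly_Mapping.lookup m' i)"
    by (simp add: lookup_add power_add prod.distrib)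
  finally show ?thesis
    by (simp add: mono_ext[of ?S])
qed

lemma subst_add: "subst g (p + q) = subst g p + subst g q"
proof -
  let ?S = "Poly_Mapping.keys p \<union> Poly_Mapping.keys q"
  have "Poly_Mapping.keys (p+q) \<subseteq> ?S" by (rule Poly_Mapping.keys_add)
  then show ?thesis
    by (simp add: subst_ext[of ?S] lookup_add Const_def single_add distrib_right sum.distrib)
qed

lemma subst_zero [simp]: "subst g 0 = 0" by (simp add: subst_def)

lemma subst_single: "subst g (Poly_Mapping.single m c) = Const c * (\<Prod>i \<in> Poly_Mapping.keys m. g i ^ Poly_Mapping.lookup m i)"
  by (subst subst_ext[of "{m}"]) auto

lemma poly_expand: "(p :: 'a \<Rightarrow>\<^sub>0 'b::comm_monoid_add) = (\<Sum>m\<in>Poly_Mapping.keys p. Poly_Mapping.single m (Poly_Mapping.lookup p m))"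
  by (rule poly_mapping_eqI) (simp add: lookup_sum lookup_single when_def in_keys_iff)

lemma subst_sum: "subst g (sum f S) = (\<Sum>x\<in>S. subst g (f x))"
  by (induction S rule: infinite_finite_induct) (auto simp: subst_add)

lemma Const_mult: "Const (a * b) = Const a * Const b" by (simp add: Const_def mult_single)

lemma subst_mult: "subst g (p * q) = subst g p * subst g q"
proof -
  let ?s = "\<lambda>p m. Poly_Mapping.single m (Poly_Mapping.lookup p m)"
  have "subst g (p * q) = subst g ((\<Sum>m\<in>Poly_Mapping.keys p. ?s p m) * (\<Sum>m\<in>Poly_Mapping.keys q. ?s q m))"
    by (simp only: poly_expand[symmetric])
  also have "\<dots> = subst g (\<Sum>m\<in>Poly_Mapping.keys p. ?s p m) * subst g (\<Sum>m\<in>Poly_Mapping.keys q. ?s q m)"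
    unfolding sum_product subst_sum
    by (intro sum.cong refl) (simp add: mult_single subst_single mono_add Const_mult mult_ac)
  finally show ?thesis by (simp only: poly_expand[symmetric])
qed

lemma subst_Const [simp]: "subst g (Const c) = Const c"
  by (simp add: Const_def subst_single)

lemma subst_Var [simp]: "subst g (Var i) = g i"
  by (simp add: Var_def subst_single Const_def)

lemma Const_1: "Const 1 = 1" by (simp add: Const_def)

lemma subst_1 [simp]: "subst g 1 = 1" using subst_Const[of g 1] by (simp add: Const_1)

lemma subst_minus: "subst g (p - q) = subst g p - subst g q"
  using subst_add[of g "p-q" q] by (simp add: algebra_simps)

lemma subst_prod: "subst g (prod f S) = (\<Prod>x\<in>S. subst g (f x))"
  by (induction S rule: infinite_finite_induct) (auto simp: subst_mult)

lemma subst_power: "subst g (p ^ k) = subst g p ^ k" by (induction k) (auto simp: subst_mult)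

lemma subst_subst: "subst g (subst h p) = subst (\<lambda>i. subst g (h i)) p"
  unfolding subst_def[of h] subst_def[of "\<lambda>i. subst g (h i)"]
  by (simp add: subst_sum subst_mult subst_prod subst_power)

lemma subst_cong:
  assumes "p \<in> polys_in V" "\<And>i. i \<in> V \<Longrightarrow> g i = h i" shows "subst g p = subst h p"
  unfolding subst_def using assms
  by (intro sum.cong prod.cong refl arg_cong2[where f="(*)"]) (fastforce simp: polys_in_def)

lemma polys_in_add: "p \<in> polys_in V \<Longrightarrow> q \<in> polys_in V \<Longrightarrow> p + q \<in> polys_in V"
  using Poly_Mapping.keys_add[of p q] by (fastforce simp: polys_in_def)

lemma polys_in_mult: "p \<in> polys_in V \<Longrightarrow> q \<in> polys_in V \<Longrightarrow> p * q \<in> polys_in V"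
  unfolding polys_in_def mem_Collect_eq
proof
  fix m assume p: "\<forall>m\<in>Poly_Mapping.keys p. Poly_Mapping.keys m \<subseteq> V"
    and q: "\<forall>m\<in>Poly_Mapping.keys q. Poly_Mapping.keys m \<subseteq> V"
    and "m \<in> Poly_Mapping.keys (p * q)"
  then obtain a b where "m = a + b" "a \<in> Poly_Mapping.keys p" "b \<in> Poly_Mapping.keys q"
    using keys_mult[of p q] by blast
  then show "Poly_Mapping.keys m \<subseteq> V"
    using p q Poly_Mapping.keys_add[of a b] by blast
qed

lemma polys_in_Const: "Const c \<in> polys_in V" by (simp add: polys_in_def Const_def)

lemma polys_in_Var: "i \<in> V \<Longrightarrow> Var i \<in> polys_in V" by (auto simp: polys_in_def Var_def)

lemma polys_in_minus: "p \<in> polys_in V \<Longrightarrow> q \<in> polys_in V \<Longrightarrow> p - q \<in> polys_in V"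
  using keys_diff[of p q] by (fastforce simp: polys_in_def)

lemma polys_in_one: "1 \<in> polys_in V" using polys_in_Const[of 1 V] by (simp add: Const_1)

lemma polys_in_zero: "0 \<in> polys_in V" by (simp add: polys_in_def)

lemma polys_in_sum: "(\<And>x. x \<in> S \<Longrightarrow> f x \<in> polys_in V) \<Longrightarrow> sum f S \<in> polys_in V"
  by (induction S rule: infinite_finite_induct) (auto intro: polys_in_add polys_in_zero)

lemma polys_in_prod: "(\<And>x. x \<in> S \<Longrightarrow> f x \<in> polys_in V) \<Longrightarrow> prod f S \<in> polys_in V"
  by (induction S rule: infinite_finite_induct) (auto intro: polys_in_mult polys_in_one)

lemma polys_in_power: "p \<in> polys_in V \<Longrightarrow> p ^ k \<in> polys_in V"
  by (induction k) (auto intro: polys_in_mult polys_in_one)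

lemma polys_in_subst:
  assumes "p \<in> polys_in V" "\<And>i. i \<in> V \<Longrightarrow> g i \<in> polys_in W" shows "subst g p \<in> polys_in W"
  unfolding subst_def using assms
  by (intro polys_in_sum polys_in_mult polys_in_Const polys_in_prod polys_in_power assms(2))
    (auto simp: polys_in_def)

lemma subst_id: "subst Var p = p"
proof -
  have pw: "Var i ^ k = (Poly_Mapping.single (Poly_Mapping.single i k) 1 :: 'a mpoly)" for i k
    by (induction k) (auto simp: Var_def mult_single single_add[symmetric])
  have pr: "(\<Prod>i\<in>S. Poly_Mapping.single (f i) 1) = (Poly_Mapping.single (\<Sum>i\<in>S. f i) 1 :: 'a mpoly)" for S f
    by (induction S rule: infinite_finite_induct) (auto simp: mult_single)
  have "subst Var p = (\<Sum>m\<in>Poly_Mapping.keys p. Poly_Mapping.single m (Poly_Mapping.lookup p m))"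
    unfolding subst_def by (simp add: pw pr poly_expand[symmetric] Const_def mult_single)
  then show ?thesis by (simp only: poly_expand[symmetric])
qed

fun hinv :: "nat \<Rightarrow> 'k::comm_ring_1 mpoly" where
  "hinv 0 = 0" | "hinv (Suc 0) = Var 1 + 1" | "hinv (Suc (Suc i)) = Var (Suc (Suc i)) - hinv (Suc i)"

text \<open>The automorphism of the theorem exists, so assuming it is not vacuous.\<close>

lemma ex_sigma:
  "\<exists>\<sigma> :: 'k::comm_ring_1 mpoly \<Rightarrow> 'k mpoly. K_algebra_automorphism (P_n n) \<sigma> \<and>
     \<sigma> (Var 1) = Var 1 - 1 \<and> (\<forall>i \<in> {2..n}. \<sigma> (Var i) = Var i + Var (i - 1))"
proof -
  define g :: "nat \<Rightarrow> 'k mpoly" where "g = (\<lambda>i. if i = 1 then Var 1 - 1 else Var i + Var (i - 1))"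
  have 1: "subst g (hinv i) = Var i" if "i \<ge> 1" for i
    using that by (induction i rule: hinv.induct) (auto simp: subst_add subst_minus g_def)
  have 2: "subst hinv (g i) = Var i" if "i \<ge> 1" for i
    using that by (cases i rule: hinv.cases) (auto simp: subst_add subst_minus g_def)
  have gP: "g i \<in> P_n n" if "i \<in> {1..n}" for i
    using that by (auto simp: g_def intro!: polys_in_add polys_in_minus polys_in_Var polys_in_one)
  have hP: "hinv i \<in> (P_n n :: 'k mpoly set)" if "i \<in> {1..n}" for i
    using that by (induction i rule: hinv.induct) (auto intro!: polys_in_add polys_in_minus polys_in_Var polys_in_one)
  have "bij_betw (subst g) (P_n n) (P_n n)"
  proof (rule bij_betw_byWitness[where f' = "subst hinv"])
    show "\<forall>p\<in>P_n n. subst hinv (subst g p) = p"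
      using subst_cong[where g="\<lambda>i. subst hinv (g i)" and h=Var and V="{1..n}"] 2
      by (auto simp: subst_subst subst_id)
    show "\<forall>p\<in>P_n n. subst g (subst hinv p) = p"
      using subst_cong[where g="\<lambda>i. subst g (hinv i)" and h=Var and V="{1..n}"] 1
      by (auto simp: subst_subst subst_id)
  qed (use gP hP polys_in_subst in blast)+
  then show ?thesis
    by (intro exI[of _ "subst g"]) (auto simp: K_algebra_automorphism_def subst_add subst_mult g_def)
qed

end

theory Submission
  imports Defs "HOL-Computational_Algebra.Polynomial"
begin

text \<open>
  The elements \<open>x\<^sub>1, y\<^sub>2, \<dots>, y\<^sub>n\<close> arise from \<open>x\<^sub>1, \<dots>, x\<^sub>n\<close> by a triangular, hence invertible,
  change of variables, and each \<open>y\<^sub>i\<close> is \<open>\<sigma>\<close>-invariant by Pascal's rule for the \<open>\<phi>\<^sub>-\<^sub>k = binom(x\<^sub>1, k)\<close>.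
  In the new coordinates \<open>\<sigma>\<close> is therefore the shift \<open>x\<^sub>1 \<mapsto> x\<^sub>1 - 1\<close>. A polynomial invariant
  under this shift, seen as a polynomial in \<open>x\<^sub>1\<close>, takes one value at all non-positive
  integers, so in characteristic zero it does not involve \<open>x\<^sub>1\<close>.
\<close>

section \<open>Polynomials and substitutions\<close>

lemma Const_0: "Const 0 = 0"
  by (simp add: Const_def)

lemma Const_add: "Const (a + b) = Const a + Const b"
  by (simp add: Const_def single_add)

lemma Const_of_nat: "Const (of_nat k) = of_nat k"
  by (induction k) (simp_all add: Const_0 Const_add Const_1)

lemma Const_uminus: "Const (- a) = - Const a"
  using Const_add[of a "- a"] by (simp add: Const_0 eq_neg_iff_add_eq_0 add.commute)

lemma inj_Const: "inj Const"
  by (rule injI) (metis Const_def lookup_single_eq)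

lemma polys_in_of_nat: "of_nat k \<in> polys_in V"
  by (metis Const_of_nat polys_in_Const)

lemma subst_of_nat [simp]: "subst g (of_nat k) = of_nat k"
  by (metis Const_of_nat subst_Const)

lemma K_subalgebra_sum:
  assumes "K_subalgebra B" "\<And>x. x \<in> S \<Longrightarrow> f x \<in> B"
  shows "sum f S \<in> B"
  using assms(2)
proof (induction S rule: infinite_finite_induct)
  case (insert x S)
  then show ?case using assms(1) by (simp add: K_subalgebra_def)
qed (use assms(1) in \<open>simp_all add: K_subalgebra_def flip: Const_0\<close>)

lemma K_subalgebra_prod:
  assumes "K_subalgebra B" "\<And>x. x \<in> S \<Longrightarrow> f x \<in> B"
  shows "prod f S \<in> B"
  using assms(2)
proof (induction S rule: infinite_finite_induct)
  case (insert x S)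
  then show ?case using assms(1) by (simp add: K_subalgebra_def)
qed (use assms(1) in \<open>simp_all add: K_subalgebra_def flip: Const_1\<close>)

text \<open>A substituted polynomial is built from constants and the \<open>g i\<close> by sums and
  products. This gives the minimality of the image of a substitution among subalgebras and the
  principle that agreement on variables suffices.\<close>

lemma K_subalgebra_subst:
  assumes B: "K_subalgebra B" and p: "p \<in> polys_in V" and g: "\<And>i. i \<in> V \<Longrightarrow> g i \<in> B"
  shows "subst g p \<in> B"
proof -
  have pow: "b ^ k \<in> B" if "b \<in> B" for b k
    using K_subalgebra_prod[OF B, of "{..<k}" "\<lambda>_. b"] that by simp
  show ?thesis
    unfolding subst_def
  proof (intro K_subalgebra_sum[OF B])
    fix m assume "m \<in> Poly_Mapping.keys p"
    then have "(\<Prod>i\<in>Poly_Mapping.keys m. g i ^ Poly_Mapping.lookup m i) \<in> B"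
      using p by (intro K_subalgebra_prod[OF B] pow g) (auto simp: polys_in_def)
    then show "Const (Poly_Mapping.lookup p m) * (\<Prod>i\<in>Poly_Mapping.keys m. g i ^ Poly_Mapping.lookup m i) \<in> B"
      using B by (simp add: K_subalgebra_def)
  qed
qed

text \<open>The polynomials on which \<open>\<sigma>\<close> agrees with \<open>subst g\<close> form
  a subalgebra containing the variables, and every \<open>p\<close> equals
  \<open>subst Var p\<close>.\<close>

lemma automorphism_eq_subst:
  assumes \<sigma>: "K_algebra_automorphism (polys_in V) \<sigma>"
    and g: "\<And>i. i \<in> V \<Longrightarrow> \<sigma> (Var i) = g i"
    and p: "p \<in> polys_in V"
  shows "\<sigma> p = subst g p"
proof -
  have "K_subalgebra {p \<in> polys_in V. \<sigma> p = subst g p}"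
    using \<sigma> by (simp add: K_subalgebra_def K_algebra_automorphism_def polys_in_Const
        polys_in_add polys_in_mult subst_add subst_mult)
  from K_subalgebra_subst[OF this p, of Var] show ?thesis
    by (simp add: g polys_in_Var subst_id)
qed

section \<open>Total degree\<close>

lemma total_degree_le_iff:
  "total_degree p \<le> d \<longleftrightarrow>
     (\<forall>m\<in>Poly_Mapping.keys p. (\<Sum>i\<in>Poly_Mapping.keys m. Poly_Mapping.lookup m i) \<le> d)"
  by (simp add: total_degree_def)

lemma monomial_degree_add:
  fixes a b :: "nat \<Rightarrow>\<^sub>0 nat"
  shows "(\<Sum>i\<in>Poly_Mapping.keys (a + b). Poly_Mapping.lookup (a + b) i) =
     (\<Sum>i\<in>Poly_Mapping.keys a. Poly_Mapping.lookup a i) + (\<Sum>i\<in>Poly_Mapping.keys b. Poly_Mapping.lookup b i)"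
proof -
  let ?S = "Poly_Mapping.keys a \<union> Poly_Mapping.keys b"
  have *: "(\<Sum>i\<in>Poly_Mapping.keys m. Poly_Mapping.lookup m i) = (\<Sum>i\<in>?S. Poly_Mapping.lookup m i)"
    if "Poly_Mapping.keys m \<subseteq> ?S" for m :: "nat \<Rightarrow>\<^sub>0 nat"
    using that by (intro sum.mono_neutral_left) (auto simp: in_keys_iff)
  show ?thesis
    unfolding *[OF Poly_Mapping.keys_add] *[OF Un_upper1] *[OF Un_upper2]
    by (simp add: lookup_add sum.distrib)
qed

lemma total_degree_add_le:
  assumes "total_degree p \<le> d" "total_degree q \<le> d" shows "total_degree (p + q) \<le> d"
  using assms Poly_Mapping.keys_add[of p q] unfolding total_degree_le_iff by blast

lemma total_degree_mult_le:
  assumes "total_degree p \<le> d" "total_degree q \<le> e" shows "total_degree (p * q) \<le> d + e"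
  unfolding total_degree_le_iff
proof
  fix m assume "m \<in> Poly_Mapping.keys (p * q)"
  then obtain a b where "m = a + b" "a \<in> Poly_Mapping.keys p" "b \<in> Poly_Mapping.keys q"
    using keys_mult[of p q] by blast
  then show "(\<Sum>i\<in>Poly_Mapping.keys m. Poly_Mapping.lookup m i) \<le> d + e"
    using assms by (simp add: total_degree_le_iff monomial_degree_add add_mono)
qed

lemma total_degree_Const [simp]: "total_degree (Const c) = 0"
  using total_degree_le_iff[of "Const c" 0] by (simp add: Const_def)

lemma total_degree_0 [simp]: "total_degree 0 = 0"
  by (simp add: total_degree_def)

lemma total_degree_Var_le: "total_degree (Var i) \<le> 1"
  by (simp add: total_degree_le_iff Var_def)

lemma total_degree_Const_mult_le: "total_degree p \<le> d \<Longrightarrow> total_degree (Const c * p) \<le> d"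
  using total_degree_mult_le[of "Const c" 0 p d] by simp

lemma total_degree_sum_le:
  "(\<And>x. x \<in> S \<Longrightarrow> total_degree (f x) \<le> d) \<Longrightarrow> total_degree (sum f S) \<le> d"
  by (induction S rule: infinite_finite_induct) (auto intro: total_degree_add_le)

lemma Var_power: "Var i ^ k = Poly_Mapping.single (Poly_Mapping.single i k) 1"
  by (induction k) (auto simp: Var_def mult_single single_add[symmetric])

lemma total_degree_Var_power_le: "total_degree (Var i ^ k) \<le> k"
  by (simp add: total_degree_le_iff Var_power)

text \<open>The monomial of \<open>Var i ^ d\<close> has larger degree than every monomial of
  \<open>r\<close>, so it cannot cancel.\<close>

lemma total_degree_eqI:
  assumes "c \<noteq> 0" "total_degree r < d" "d > 0"
  shows "total_degree (Const c * Var i ^ d + r) = d"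
proof (rule antisym)
  show "total_degree (Const c * Var i ^ d + r) \<le> d"
    using assms by (intro total_degree_add_le total_degree_Const_mult_le total_degree_Var_power_le) simp
  have "Poly_Mapping.single i d \<notin> Poly_Mapping.keys r"
    using assms total_degree_le_iff[of r "total_degree r"] by auto
  then have "Poly_Mapping.single i d \<in> Poly_Mapping.keys (Const c * Var i ^ d + r)"
    using assms(1) by (simp add: in_keys_iff lookup_add Var_power Const_def mult_single)
  then show "d \<le> total_degree (Const c * Var i ^ d + r)"
    using total_degree_le_iff[of "Const c * Var i ^ d + r" "total_degree (Const c * Var i ^ d + r)"] assms(3)
    by auto
qed

section \<open>Invariants of the shift of one variable\<close>

lemma shift_invariant_imp_free:
  fixes q :: "'k::field_char_0 mpoly"
  assumes inv: "subst (Var(v := Var v - 1)) q = q" and q: "q \<in> polys_in V"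
  shows "q \<in> polys_in (V - {v})"
proof -
  define f where "f t = subst (Var(v := t)) q" for t :: "'k mpoly"
  \<comment> \<open>\<open>U\<close> is \<open>q\<close> read as a univariate polynomial in the
    variable \<open>v\<close>, with coefficients in the other variables; its value at
    \<open>t\<close> is \<open>f t\<close>.\<close>
  define U :: "'k mpoly poly" where
    "U = (\<Sum>m\<in>Poly_Mapping.keys q. [:Const (Poly_Mapping.lookup q m):] *
           (\<Prod>i\<in>Poly_Mapping.keys m. (if i = v then [:0, 1:] else [:Var i:]) ^ Poly_Mapping.lookup m i))"
  have U: "poly U t = f t" for t
    unfolding U_def f_def subst_def by (auto simp: poly_sum poly_prod intro!: sum.cong prod.cong)
  have step: "f (t - 1) = f t" for t
  proof -
    have "f t = subst (Var(v := t)) (subst (Var(v := Var v - 1)) q)"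
      by (simp add: f_def inv)
    also have "\<dots> = subst (Var(v := t - 1)) q"
      unfolding subst_subst by (intro arg_cong2[where f = subst] ext refl) (simp add: subst_minus)
    finally show ?thesis by (simp add: f_def)
  qed
  have root: "f (Const (- of_nat k)) = f 0" for k
  proof (induction k)
    case (Suc k)
    have "Const (- of_nat (Suc k)) = Const (- of_nat k) - (1 :: 'k mpoly)"
      by (simp only: Const_uminus Const_of_nat) simp
    with Suc step show ?case by metis
  qed (simp add: Const_0)
  \<comment> \<open>Characteristic zero makes these constants distinct, so
    \<open>U - [:f 0:]\<close> has infinitely many roots in an integral domain and vanishes.\<close>
  have "inj (\<lambda>k. Const (- of_nat k :: 'k))"
    by (rule injI) (auto dest: injD[OF inj_Const])
  then have "infinite (range (\<lambda>k. Const (- of_nat k :: 'k)))"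
    using finite_imageD by blast
  moreover have "range (\<lambda>k. Const (- of_nat k :: 'k)) \<subseteq> {t. poly (U - [:f 0:]) t = 0}"
    using root by (auto simp: U)
  ultimately have "U - [:f 0:] = 0"
    using poly_roots_finite finite_subset by blast
  \<comment> \<open>Evaluation at \<open>Var v\<close> returns \<open>q\<close> itself, while
    evaluation at 0 removes the variable \<open>v\<close>.\<close>
  then have "f (Var v) = f 0"
    using U[of "Var v"] by simp
  then have "q = subst (Var(v := 0)) q"
    by (simp add: f_def subst_id)
  also have "\<dots> \<in> polys_in (V - {v})"
    using q by (rule polys_in_subst) (auto intro: polys_in_Var polys_in_zero)
  finally show ?thesis .
qed

section \<open>The binomial polynomials\<close>

lemma falling_factorial_shift:
  fixes x :: "'a::comm_ring_1"
  shows "x * (\<Prod>j<k. x - 1 - of_nat j) = (\<Prod>j<Suc k. x - of_nat j)"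
  by (simp only: prod.lessThan_Suc_shift) (simp add: algebra_simps)

lemma phi_0 [simp]: "phi 0 = 1"
  by (simp add: phi_def Const_1)

lemma phi_in: "1 \<in> V \<Longrightarrow> phi k \<in> polys_in V"
  unfolding phi_def
  by (auto intro!: polys_in_mult polys_in_Const polys_in_prod polys_in_minus polys_in_Var polys_in_of_nat)

lemma subst_phi:
  "subst g (phi k) = Const (1 / fact k) * (\<Prod>j<k. g 1 - of_nat j)"
  by (simp add: phi_def subst_mult subst_prod subst_minus)

lemma subst_phi_id: "g 1 = Var 1 \<Longrightarrow> subst g (phi k) = phi k"
  by (subst subst_phi) (simp only: phi_def)

lemma Const_fact_Suc:
  "Const (1 / fact (Suc k)) * of_nat (Suc k) = (Const (1 / fact k) :: 'k::field_char_0 mpoly)"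
proof -
  have "(1 / fact (Suc k)) * of_nat (Suc k) = (1 / fact k :: 'k)"
    by (simp add: divide_simps del: of_nat_Suc)
  then show ?thesis by (metis Const_mult Const_of_nat)
qed

text \<open>Absorption identity x binom(x-1, k) = (k+1) binom(x, k+1). It explains the factor
  \<open>i - 1\<close> in \<open>inv_gen i\<close>.\<close>

lemma Var_mult_subst_phi:
  fixes g :: "nat \<Rightarrow> 'k::field_char_0 mpoly"
  assumes "g 1 = Var 1 - 1"
  shows "Var 1 * subst g (phi k) = of_nat (Suc k) * phi (Suc k)"
proof -
  have "Var 1 * subst g (phi k) = Const (1 / fact k) * (\<Prod>j<Suc k. Var 1 - of_nat j)"
    by (simp only: subst_phi assms falling_factorial_shift[symmetric] mult.left_commute)
  also have "\<dots> = of_nat (Suc k) * phi (Suc k)"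
    unfolding phi_def Const_fact_Suc[of k, symmetric] by (simp only: ac_simps)
  finally show ?thesis .
qed

text \<open>Both summands on the right share the factor (x-1)...(x-k)/(k+1)!, and the cofactors
  x-1-k and k+1 add up to x.\<close>

lemma phi_pascal:
  fixes g :: "nat \<Rightarrow> 'k::field_char_0 mpoly"
  assumes "g 1 = Var 1 - 1"
  shows "phi (Suc k) = subst g (phi (Suc k)) + subst g (phi k)"
proof -
  let ?P = "\<Prod>j<k. Var 1 - 1 - of_nat j :: 'k mpoly"
  let ?c = "Const (1 / fact (Suc k)) :: 'k mpoly"
  have "subst g (phi (Suc k)) + subst g (phi k) = ?c * (?P * (Var 1 - 1 - of_nat k)) + ?c * of_nat (Suc k) * ?P"
    unfolding Const_fact_Suc subst_phi assms by (simp only: prod.lessThan_Suc)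
  also have "\<dots> = ?c * (Var 1 * ?P)"
    by (simp add: algebra_simps)
  also have "\<dots> = phi (Suc k)"
    by (simp only: falling_factorial_shift phi_def)
  finally show ?thesis by simp
qed

text \<open>The second bound says that the product is monic up to lower degree. Adding the power
  back to it yields the first bound for the next \<open>k\<close>.\<close>

lemma total_degree_falling_factorial:
  "total_degree ((\<Prod>j<k. Var i - of_nat j) :: 'k::comm_ring_1 mpoly) \<le> k \<and>
   total_degree ((\<Prod>j<Suc k. Var i - of_nat j) - Var i ^ Suc k :: 'k mpoly) \<le> k"
proof (induction k)
  case 0
  then show ?case by (simp add: Const_1[symmetric])
next
  case (Suc k)
  let ?P = "\<lambda>k. \<Prod>j<k. Var i - of_nat j :: 'k mpoly"
  have split: "?P (Suc k) = (?P (Suc k) - Var i ^ Suc k) + Var i ^ Suc k"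
    by simp
  have 1: "total_degree (?P (Suc k)) \<le> Suc k"
    by (subst split) (intro total_degree_add_le total_degree_Var_power_le Suc.IH[THEN conjunct2, THEN le_SucI])
  \<comment> \<open>With \<open>p\<close> the product and \<open>q\<close> the power, this expresses
    the new error term by the old one and a multiple of \<open>p\<close>, whose degrees are already
    bounded.\<close>
  have expand: "p * (x - c) - q * x = (p - q) * x + - c * p" for p q x c :: "'k mpoly"
    by (simp add: algebra_simps)
  have "?P (Suc (Suc k)) - Var i ^ Suc (Suc k) =
      (?P (Suc k) - Var i ^ Suc k) * Var i + Const (- of_nat (Suc k)) * ?P (Suc k)"
    unfolding prod.lessThan_Suc[of _ "Suc k"] power_Suc2[of _ "Suc k"] Const_uminus Const_of_nat
    by (rule expand)
  moreover have "total_degree \<dots> \<le> Suc k"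
    using total_degree_mult_le[of "?P (Suc k) - Var i ^ Suc k" k "Var i" 1] Suc 1 total_degree_Var_le[of i]
    by (intro total_degree_add_le total_degree_Const_mult_le) auto
  ultimately show ?case using 1 by metis
qed

lemma total_degree_phi_le: "total_degree (phi k) \<le> k"
  unfolding phi_def using total_degree_falling_factorial by (blast intro: total_degree_Const_mult_le)

lemma phi_Suc_leading:
  obtains r where "phi (Suc k) = Const (1 / fact (Suc k)) * Var 1 ^ Suc k + r" "total_degree r \<le> k"
proof
  let ?r = "(\<Prod>j<Suc k. Var 1 - of_nat j) - Var 1 ^ Suc k"
  show "phi (Suc k) = Const (1 / fact (Suc k)) * Var 1 ^ Suc k + Const (1 / fact (Suc k)) * ?r"
    unfolding phi_def distrib_left[symmetric] by simp
  show "total_degree (Const (1 / fact (Suc k)) * ?r) \<le> k"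
    using total_degree_falling_factorial by (blast intro: total_degree_Const_mult_le)
qed

section \<open>The invariant generators\<close>

text \<open>For \<open>i \<ge> 2\<close> this is the paper's \<open>y\<^sub>i\<close>, with \<open>\<sigma>\<inverse>(\<phi>\<^sub>-\<^sub>i)\<close> replaced by \<open>\<phi>\<^sub>-\<^sub>i + \<phi>\<^sub>-\<^sub>i\<^sub>+\<^sub>1\<close>; the remaining
  variables are kept, so that the family is a change of variables.\<close>

definition inv_gen :: "nat \<Rightarrow> 'k::field_char_0 mpoly" where
  "inv_gen i = (if i < 2 then Var i
     else (\<Sum>j=2..i. phi (i - j) * Var j) + of_nat (i - 1) * (phi i + phi (i - 1)))"

text \<open>The congruence rule lets the termination proof below see that the recursive calls under
  the sum have \<open>j < i\<close>.\<close>

declare sum.cong [fundef_cong]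

text \<open>Forward substitution in the unitriangular system defining \<open>inv_gen\<close>. The
  coefficients \<open>phi\<close> involve only \<open>Var 1\<close>, which both substitutions
  fix.\<close>

fun inv_gen_inverse :: "nat \<Rightarrow> 'k::field_char_0 mpoly" where
  "inv_gen_inverse i = (if i < 2 then Var i
     else Var i - (\<Sum>j\<in>{2..<i}. phi (i - j) * inv_gen_inverse j)
            - of_nat (i - 1) * (phi i + phi (i - 1)))"

declare inv_gen_inverse.simps [simp del]

lemma inv_gen_1: "inv_gen 1 = Var 1" "inv_gen_inverse 1 = Var 1"
  by (simp_all add: inv_gen_def inv_gen_inverse.simps)

text \<open>The summand \<open>j = i\<close> has coefficient \<open>phi 0 = 1\<close>.\<close>

lemma inv_gen_triangular:
  "i \<ge> 2 \<Longrightarrow> inv_gen i =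
     Var i + (\<Sum>j\<in>{2..<i}. phi (i - j) * Var j) + of_nat (i - 1) * (phi i + phi (i - 1))"
  by (simp add: inv_gen_def sum.last_plus)

lemma subst_inv_gen_inverse:
  "subst inv_gen (inv_gen_inverse i) = (Var i :: 'k::field_char_0 mpoly)"
proof (induction i rule: less_induct)
  case (less i)
  show ?case
  proof (cases "i < 2")
    case True
    then show ?thesis by (simp add: inv_gen_inverse.simps inv_gen_def)
  next
    case False
    then have "subst inv_gen (inv_gen_inverse i) =
        inv_gen i - (\<Sum>j\<in>{2..<i}. phi (i - j) * Var j) - of_nat (i - 1) * (phi i + phi (i - 1) :: 'k mpoly)"
      by (subst inv_gen_inverse.simps)
        (simp add: subst_minus subst_sum subst_mult subst_add subst_phi_id[of inv_gen, OF inv_gen_1(1)]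
          less.IH del: of_nat_diff One_nat_def)
    then show ?thesis using False by (simp add: inv_gen_triangular)
  qed
qed

lemma subst_inverse_inv_gen:
  "subst inv_gen_inverse (inv_gen i) = (Var i :: 'k::field_char_0 mpoly)"
proof (cases "i < 2")
  case True
  then show ?thesis by (simp add: inv_gen_inverse.simps inv_gen_def)
next
  case False
  then have "subst inv_gen_inverse (inv_gen i) = inv_gen_inverse i +
      (\<Sum>j\<in>{2..<i}. phi (i - j) * inv_gen_inverse j) + of_nat (i - 1) * (phi i + phi (i - 1) :: 'k mpoly)"
    by (simp add: inv_gen_triangular subst_sum subst_mult subst_add 
        subst_phi_id[of inv_gen_inverse, OF inv_gen_1(2)] del: of_nat_diff One_nat_def)
  also have "\<dots> = Var i"
    using False by (subst inv_gen_inverse.simps) simp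
  finally show ?thesis .
qed

lemma subst_inv_gen_cancel: "subst inv_gen (subst inv_gen_inverse p) = p"
  by (simp add: subst_subst subst_inv_gen_inverse subst_id)

lemma subst_inverse_cancel: "subst inv_gen_inverse (subst inv_gen p) = p"
  by (simp add: subst_subst subst_inverse_inv_gen subst_id)

lemma inv_gen_in: "1 \<le> i \<Longrightarrow> i \<le> n \<Longrightarrow> inv_gen i \<in> P_n n"
  unfolding inv_gen_def
  by (auto intro!: polys_in_Var polys_in_add polys_in_minus polys_in_sum polys_in_mult
      polys_in_of_nat polys_in_one phi_in)

lemma inv_gen_inverse_in: "1 \<le> i \<Longrightarrow> i \<le> n \<Longrightarrow> inv_gen_inverse i \<in> P_n n"
proof (induction i rule: less_induct)
  case (less i)
  then show ?case
    by (subst inv_gen_inverse.simps)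
      (auto intro!: polys_in_Var polys_in_add polys_in_minus polys_in_sum polys_in_mult
        polys_in_of_nat polys_in_one phi_in)
qed

text \<open>Under \<open>g\<close> the sum gains \<open>(i - 1) * phi (i - 1)\<close>, by Pascal's
  rule and then absorption, while the correction \<open>phi i + phi (i - 1)\<close> becomes
  \<open>phi i\<close> and loses exactly the same amount.\<close>

lemma inv_gen_invariant:
  assumes g1: "g 1 = Var 1 - 1"
    and g: "\<And>j. 2 \<le> j \<Longrightarrow> j \<le> i \<Longrightarrow> g j = Var j + Var (j - 1)"
    and "i \<ge> 2"
  shows "subst g (inv_gen i) = inv_gen i"
proof -
  define m where "m = i - 2"
  have i: "i = Suc (Suc m)"
    using \<open>i \<ge> 2\<close> by (simp add: m_def)
  define a where "a k = subst g (phi k)" for k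
  have pascal: "phi (Suc k) = a (Suc k) + a k" for k
    unfolding a_def by (rule phi_pascal[of g, OF g1])
  have "(\<Sum>j=2..i. a (i - j) * Var (j - 1)) = (\<Sum>j=1..Suc m. a (Suc m - j) * Var j)"
    unfolding i numeral_2_eq_2
    by (subst sum.shift_bounds_cl_Suc_ivl) (simp only: diff_Suc_Suc diff_zero One_nat_def)
  also have "\<dots> = a m * Var 1 + (\<Sum>j=2..Suc m. a (Suc m - j) * Var j)"
    by (subst sum.atLeast_Suc_atMost) (simp_all add: numeral_2_eq_2)
  finally have low: "(\<Sum>j=2..i. a (i - j) * Var (j - 1)) = \<dots>" .
  \<comment> \<open>The index \<open>j = i\<close> has no partner in the shifted sum; its
    coefficient \<open>a 0 = 1 = phi 0\<close> already agrees, and the term is added back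
    next.\<close>
  have "(\<Sum>j=2..Suc m. a (i - j) * Var j) + (\<Sum>j=2..Suc m. a (Suc m - j) * Var j) =
      (\<Sum>j=2..Suc m. phi (i - j) * Var j)"
    unfolding sum.distrib[symmetric]
    by (intro sum.cong refl) (simp add: i Suc_diff_le pascal distrib_right)
  then have "(\<Sum>j=2..i. a (i - j) * (Var j + Var (j - 1))) =
      (\<Sum>j=2..i. phi (i - j) * Var j) + a m * Var 1"
    unfolding distrib_left sum.distrib low by (simp add: i a_def)
  also have "a m * Var 1 = of_nat (Suc m) * phi (Suc m)"
    using Var_mult_subst_phi[of g, OF g1, of m] by (simp only: a_def mult.commute)
  finally have "(\<Sum>j=2..i. a (i - j) * (Var j + Var (j - 1))) =
      (\<Sum>j=2..i. phi (i - j) * Var j) + of_nat (Suc m) * phi (Suc m)" .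
  moreover have "(\<Sum>j=2..i. subst g (phi (i - j)) * subst g (Var j)) = (\<Sum>j=2..i. a (i - j) * (Var j + Var (j - 1)))"
    by (intro sum.cong refl) (simp add: a_def g)
  moreover have "subst g (phi i) + subst g (phi (i - 1)) = phi i"
    using phi_pascal[of g, OF g1, of "Suc m"] by (simp add: i)
  moreover have "i - 1 = Suc m" by (simp add: i)
  moreover have "\<not> i < 2" using \<open>i \<ge> 2\<close> by simp
  ultimately show ?thesis
    unfolding inv_gen_def
    by (simp only: if_False subst_add subst_sum subst_mult subst_of_nat) (simp only: distrib_left ac_simps)
qed

text \<open>The leading term is (i-1)/i! times \<open>Var 1 ^ i\<close>, from \<open>phi i\<close>;
  each \<open>phi (i - j) * Var j\<close> has degree at most i-j+1 < i because j is at least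
  2.\<close>

lemma total_degree_inv_gen:
  assumes "i \<ge> 2"
  shows "total_degree (inv_gen i :: 'k::field_char_0 mpoly) = i"
proof -
  obtain k where i: "i = Suc k" and k: "k \<ge> 1"
    using assms by (cases i) auto
  obtain r :: "'k mpoly" where r: "phi i = Const (1 / fact i) * Var 1 ^ i + r" "total_degree r \<le> k"
    unfolding i by (rule phi_Suc_leading)
  let ?s = "(\<Sum>j=2..i. phi (i - j) * Var j) + Const (of_nat k) * (r + phi k)"
  have "total_degree (phi (i - j) * Var j :: 'k mpoly) \<le> k" if "j \<in> {2..i}" for j
  proof -
    have "total_degree (phi (i - j) * Var j :: 'k mpoly) \<le> i - j + 1"
      by (intro total_degree_mult_le total_degree_phi_le total_degree_Var_le)
    also have "\<dots> \<le> k" using that by (auto simp: i)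
    finally show ?thesis .
  qed
  then have s: "total_degree ?s < i"
    unfolding i less_Suc_eq_le
    by (intro total_degree_add_le total_degree_sum_le total_degree_Const_mult_le total_degree_phi_le r)
      (simp add: i)
  have eq: "inv_gen i = Const (of_nat k / fact i) * Var 1 ^ i + ?s"
  proof -
    have "Const (of_nat k / fact i) = Const (of_nat k) * (Const (1 / fact i) :: 'k mpoly)"
      by (simp flip: Const_mult)
    moreover have "inv_gen i = (\<Sum>j=2..i. phi (i - j) * Var j) + Const (of_nat k) * (phi i + phi k :: 'k mpoly)"
      using assms by (simp add: inv_gen_def i Const_of_nat)
    ultimately show ?thesis
      unfolding r(1) by (simp only: algebra_simps)
  qed
  have "of_nat k / fact i \<noteq> (0 :: 'k)"
    using k by simp
  then show ?thesis
    unfolding eq by (rule total_degree_eqI) (use s assms in simp_all)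
qed

section \<open>The algebra of invariants\<close>

lemma invariants_subst:
  fixes g :: "nat \<Rightarrow> 'k::field_char_0 mpoly"
  assumes "n \<ge> 1" and g1: "g 1 = Var 1 - 1"
    and g: "\<And>j. 2 \<le> j \<Longrightarrow> j \<le> n \<Longrightarrow> g j = Var j + Var (j - 1)"
  shows "invariants (P_n n) (subst g) = subst inv_gen ` polys_in {2..n}"
proof -
  have inv: "subst g (inv_gen i) = inv_gen i" if "i \<in> {2..n}" for i
    using that by (intro inv_gen_invariant g1 g) auto
  show ?thesis
  proof (intro equalityI subsetI)
    fix p assume "p \<in> invariants (P_n n) (subst g)"
    then have p: "p \<in> P_n n" "subst g p = p" by (auto simp: invariants_def)
    define q where "q = subst inv_gen_inverse p"
    have q: "q \<in> P_n n"
      unfolding q_def using p(1) by (rule polys_in_subst) (simp add: inv_gen_inverse_in del: One_nat_def)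
    \<comment> \<open>The change of variables conjugates \<open>subst g\<close> into the shift of
      \<open>Var 1\<close>: this is checked on \<open>Var 1\<close> directly and on the other
      variables by invariance of \<open>inv_gen i\<close>.\<close>
    have "subst inv_gen (subst (Var(1 := Var 1 - 1)) q) = subst g (subst inv_gen q)"
      unfolding subst_subst using q
    proof (rule subst_cong)
      fix i :: nat assume "i \<in> {1..n}"
      then show "subst inv_gen ((Var(1 := Var 1 - 1)) i) = subst g (inv_gen i)"
        using inv[of i] by (cases "i = 1") (simp_all add: subst_minus inv_gen_1(1) g1 del: One_nat_def)
    qed
    also have "\<dots> = subst inv_gen q"
      by (simp add: q_def subst_inv_gen_cancel p)
    finally have "subst (Var(1 := Var 1 - 1)) q = q"
      by (metis subst_inverse_cancel)
    then have "q \<in> polys_in ({1..n} - {1})"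
      using q by (rule shift_invariant_imp_free)
    moreover have "{1..n} - {1} = {2..n}" by auto
    ultimately show "p \<in> subst inv_gen ` polys_in {2..n}"
      by (metis image_eqI q_def subst_inv_gen_cancel)
  next
    fix p :: "'k mpoly" assume "p \<in> subst inv_gen ` polys_in {2..n}"
    then obtain q where q: "q \<in> polys_in {2..n}" "p = subst inv_gen q" by blast
    have "p \<in> P_n n"
      unfolding q(2) using q(1) by (rule polys_in_subst) (simp add: inv_gen_in del: One_nat_def)
    moreover have "subst g p = p"
      unfolding q(2) subst_subst using q(1) by (rule subst_cong) (rule inv)
    ultimately show "p \<in> invariants (P_n n) (subst g)"
      by (simp add: invariants_def)
  qed
qed

lemma hull_eq_subst_image: "K_subalgebra hull (y ` I) = subst y ` polys_in I"
proof (rule hull_unique)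
  show "y ` I \<subseteq> subst y ` polys_in I"
    by (metis (no_types, lifting) image_eqI image_subsetI polys_in_Var subst_Var)
  show "K_subalgebra (subst y ` polys_in I)"
    unfolding K_subalgebra_def
  proof (intro conjI allI ballI)
    show "Const c \<in> subst y ` polys_in I" for c
      by (metis image_eqI polys_in_Const subst_Const)
  qed (auto simp flip: subst_add subst_mult intro!: imageI polys_in_add polys_in_mult)
  show "subst y ` polys_in I \<subseteq> B" if "y ` I \<subseteq> B" "K_subalgebra B" for B
    using that by (auto intro: K_subalgebra_subst)
qed

theorem theorem1p1:
  fixes n :: nat
    and \<sigma> :: "'k::field_char_0 mpoly \<Rightarrow> 'k mpoly"
    and y :: "nat \<Rightarrow> 'k mpoly"
  assumes "n \<ge> 2"
    and "K_algebra_automorphism (P_n n) \<sigma>"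
    and "\<sigma> (Var 1) = Var 1 - 1"
    and "\<And>i. i \<in> {2..n} \<Longrightarrow> \<sigma> (Var i) = Var i + Var (i - 1)"
    and "\<And>i. i \<in> {1..n - 1} \<Longrightarrow>
           y (i + 1) = (\<Sum>j = 1..i. phi (i - j) * Var (j + 1))
                        + of_nat i * inv_into (P_n n) \<sigma> (phi (i + 1))"
  shows "is_polynomial_algebra_in (invariants (P_n n) \<sigma>) {2..n} y \<and>
    (\<forall>i \<in> {1..n - 1}. total_degree (y (i + 1)) = i + 1)"
proof -
  define g :: "nat \<Rightarrow> 'k mpoly" where "g i = (if i = 1 then Var 1 - 1 else Var i + Var (i - 1))" for i
  have g1: "g 1 = Var 1 - 1" by (simp add: g_def)
  have \<sigma>: "\<sigma> p = subst g p" if "p \<in> P_n n" for p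
    using assms(2) _ that
  proof (rule automorphism_eq_subst)
    fix i assume "i \<in> {1..n}"
    then show "\<sigma> (Var i) = g i"
      using assms(3) assms(4)[of i] by (cases "i = 1") (auto simp: g_def)
  qed
  have phi: "phi k \<in> P_n n" for k
    using \<open>n \<ge> 2\<close> by (auto intro: phi_in)
  \<comment> \<open>Pascal's rule exhibits the preimage, and injectivity makes it the value of
    \<open>inv_into\<close>.\<close>
  have \<sigma>_inv: "inv_into (P_n n) \<sigma> (phi (Suc k)) = phi (Suc k) + phi k" for k
  proof (rule inv_into_f_eq)
    show "inj_on \<sigma> (P_n n)"
      using assms(2) by (simp add: K_algebra_automorphism_def bij_betw_def)
    show mem: "phi (Suc k) + phi k \<in> P_n n"
      by (intro polys_in_add phi)
    show "\<sigma> (phi (Suc k) + phi k) = phi (Suc k)"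
      using phi_pascal[of g, OF g1, of k] by (simp add: \<sigma>[OF mem] subst_add)
  qed
  have y: "y i = inv_gen i" if i2: "i \<in> {2..n}" for i
  proof -
    obtain k where i: "i = Suc k" using i2 by (cases i) auto
    have "y i = (\<Sum>j=1..k. phi (k - j) * Var (Suc j)) + of_nat k * (phi (Suc k) + phi k)"
      using assms(5)[of k] i2 unfolding \<sigma>_inv[of k, symmetric] by (auto simp: i)
    also have "(\<Sum>j=1..k. phi (k - j) * Var (Suc j)) = (\<Sum>j=2..i. phi (i - j) * Var j :: 'k mpoly)"
      unfolding i numeral_2_eq_2 sum.shift_bounds_cl_Suc_ivl by simp
    finally show ?thesis
      using i2 by (simp add: inv_gen_def i)
  qed
  \<comment> \<open>Outside \<open>{2..n}\<close> the family \<open>y\<close> is arbitrary, so the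
    agreement is restricted to polynomials in these indices.\<close>
  have subst_y: "subst y p = subst inv_gen p" if "p \<in> polys_in {2..n}" for p
    using that y by (rule subst_cong)
  have "invariants (P_n n) \<sigma> = invariants (P_n n) (subst g)"
    using \<sigma> by (auto simp: invariants_def)
  also have "\<dots> = subst inv_gen ` polys_in {2..n}"
    using \<open>n \<ge> 2\<close> by (intro invariants_subst) (auto simp: g_def)
  also have "\<dots> = K_subalgebra hull (y ` {2..n})"
    unfolding hull_eq_subst_image using subst_y by (intro image_cong) simp_all
  finally have "invariants (P_n n) \<sigma> = K_subalgebra hull (y ` {2..n})" .
  \<comment> \<open>\<open>subst inv_gen\<close> has the left inverse
    \<open>subst inv_gen_inverse\<close>, so only 0 is sent to 0.\<close>
  moreover have "alg_independent {2..n} y"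
    unfolding alg_independent_def by (metis subst_y subst_inverse_cancel subst_zero)
  moreover have "total_degree (y (i + 1)) = i + 1" if "i \<in> {1..n - 1}" for i
    using that by (subst y) (auto intro: total_degree_inv_gen)
  ultimately show ?thesis
    by (simp add: is_polynomial_algebra_in_def)
qed

end
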